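(* Let $\beta : \mathbb{N} \to \mathbb{N}$ and let $w : Int_{\omega,*}(\mathbb{N}) \to \mathbb{N}$ be a function such that $$\forall [\![a,b]\!] \in Int_{\omega,*}(\mathbb{N}) : w([\![a,b]\!]) \in [\![a,b]\!] \text{ and } \beta([\![a,b]\!] \setminus \{w([\![a,b]\!])\}) \subseteq [\![a,b]\!].$$ Let $\{b_n\}_{n \in [\![0,l]\!]}$ be the sequence of non-fixed points of $\beta$ in strictly increasing order, where $l \in \mathbb{N} \cup \{-1,\infty\}$. Extend this sequence and $\beta$ by setting $b_{-1} = -1$ and $\beta(-1) = 0$, and, if $l < \infty$, set $b_{l+1} = \infty$. Then at least one of the following holds. Case 1. $\forall n \in [\![0,l]\!] : b_n < \beta(b_n) \le b_{n+1}$, and for every $[\![a,b]\!] \in Int_{\omega,*}(\mathbb{N})$: $w([\![a,b]\!]) = b_n$ if there exists a unique $n \in [\![0,l]\!]$ such that $b_n \in [\![a,b]\!]$ and $\beta(b_n) > b$; and $w([\![a,b]\!])$ is any element of $[\![a,b]\!]$ otherwise. Case 2. There exists $n^* \in [\![-1,l-1]\!]$ such that $b_m < \beta(b_m) \le b_{m+1}$ for all $m \in [\![-1,n^*]\!]$, $\beta(b_{n^*+1}) < b_{n^*+1}$, $b_{m-1} \le \beta(b_m) < b_m$ for all $m \in [\![n^*+2,l]\!]$, and for every $[\![a,b]\!] \in Int_{\omega,*}(\mathbb{N})$: $w([\![a,b]\!]) = b_n$ if there exists a unique $n \in [\![0,n^*]\!]$ such that $b_n \in [\![a,b]\!]$ and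 $\beta(b_n) > b$; $w([\![a,b]\!]) = b_n$ if there exists a unique $n \in [\![n^*+1,l]\!]$ such that $b_n \in [\![a,b]\!]$ and $\beta(b_n) < a$; and $w([\![a,b]\!])$ is any element of $[\![a,b]\!]$ otherwise. Case 3. There exists $n^* \in [\![-1,l-1]\!]$ such that $b_m < \beta(b_m) \le b_{m+1}$ for all $m \in [\![-1,n^*]\!]$, $\beta(b_{n^*+1}) > b_{n^*+2}$, $b_{m-1} \le \beta(b_m) < b_m$ for all $m \in [\![n^*+2,l]\!]$, and for every $[\![a,b]\!] \in Int_{\omega,*}(\mathbb{N})$: $w([\![a,b]\!]) = b_n$ if there exists a unique $n \in [\![0,n^*]\!]$ such that $b_n \in [\![a,b]\!]$ and $\beta(b_n) > b$; $w([\![a,b]\!]) = b_n$ if there exists a unique $n \in [\![n^*+1,l]\!]$ such that $b_n \in [\![a,b]\!]$ and $\beta(b_n) < a$; and $w([\![a,b]\!])$ is any element of $[\![a,b]\!]$ otherwise.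
   Context: $\mathbb{N} = \{0,1,2,\dots\}$. $[\![a,b]\!]$ denotes the set of integers $x$ with $a \le x \le b$; it is empty if $a > b$, and if the upper bound is $\infty$ it consists of all (finite) integers $\ge a$ (with $\infty - 1 = \infty$). $Int_{\omega,*}(\mathbb{N})$ is the set of all intervals $[\![a,b]\!]$ with $a \le b$ in $\mathbb{N}$. The value $l = -1$ means that $\beta$ has no non-fixed point, and $l = \infty$ means that it has infinitely many. Every integer is $< \infty$. "Any element of $[\![a,b]\!]$ otherwise" means that nothing beyond $w([\![a,b]\!]) \in [\![a,b]\!]$ is asserted for such intervals. *)

theory Defs
  imports "HOL-Library.Extended"
begin

definition Int_fin :: "nat set set" where
  "Int_fin = {{x..y} | x y. x \<le> y}"

text \<open>
  Indices are integers, and an upper bound for indices may be \<open>\<infinity>\<close>; the interval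
  itself never contains \<open>\<infinity>\<close>.
\<close>
definition idx :: "int \<Rightarrow> int extended \<Rightarrow> int set" where
  "idx i u = {n. i \<le> n \<and> Fin n \<le> u}"

text \<open>
  The extension of \<open>\<beta>\<close> by \<open>\<beta>(-1) = 0\<close>, on the type in which the extended sequence of
  non-fixed points takes its values. Only arguments \<open>Fin x\<close> with \<open>x \<ge> -1\<close> are meaningful.
\<close>
fun ext :: "(nat \<Rightarrow> nat) \<Rightarrow> int extended \<Rightarrow> int extended" where
  "ext \<beta> (Fin x) = (if x = -1 then Fin 0 else Fin (int (\<beta> (nat x))))"
| "ext \<beta> Pinf = Pinf"
| "ext \<beta> Minf = Minf"

text \<open>
  \<open>b\<close> lists the non-fixed points of \<open>\<beta>\<close> in strictly increasing order on the indices from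
  \<open>0\<close> to \<open>l\<close>, and is extended by \<open>b (-1) = -1\<close> and, if \<open>l\<close> is finite, \<open>b (l + 1) = \<infinity>\<close>;
  its values at other indices are arbitrary.
\<close>
definition nonfixed_seq :: "(nat \<Rightarrow> nat) \<Rightarrow> int extended \<Rightarrow> (int \<Rightarrow> int extended) \<Rightarrow> bool" where
  "nonfixed_seq \<beta> l b \<longleftrightarrow>
     l \<in> {Fin (int k) | k. True} \<union> {Fin (-1), Pinf} \<and>
     strict_mono_on (idx 0 l) b \<and>
     b ` idx 0 l = {Fin (int x) | x. \<beta> x \<noteq> x} \<and>
     b (-1) = Fin (-1) \<and>
     (\<forall>k. l = Fin k \<longrightarrow> b (k + 1) = Pinf)"

definition exits_above :: "(nat \<Rightarrow> nat) \<Rightarrow> (int \<Rightarrow> int extended) \<Rightarrow> nat \<Rightarrow> nat \<Rightarrow> int \<Rightarrow> bool" where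
  "exits_above \<beta> b x y n \<longleftrightarrow> b n \<in> {Fin (int x)..Fin (int y)} \<and> ext \<beta> (b n) > Fin (int y)"

definition exits_below :: "(nat \<Rightarrow> nat) \<Rightarrow> (int \<Rightarrow> int extended) \<Rightarrow> nat \<Rightarrow> nat \<Rightarrow> int \<Rightarrow> bool" where
  "exits_below \<beta> b x y n \<longleftrightarrow> b n \<in> {Fin (int x)..Fin (int y)} \<and> ext \<beta> (b n) < Fin (int x)"

end

theory Submission
  imports Defs
begin

text \<open>
  The hypothesis on \<open>w\<close> says that at most one point of each interval leaves it under
  \<open>\<beta>\<close>, and that \<open>w\<close> selects this point if there is one; this gives all assertions
  about \<open>w\<close>. For two consecutive non-fixed points \<open>p < q\<close>, apply it to \<open>{p..q}\<close>: not
  both of \<open>p\<close> and \<open>q\<close> leave. Hence a point moved down is never followed by a point moved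
  up, so the non-fixed points are first moved up and then moved down, and a point is moved
  past its neighbour only where the direction changes. Let \<open>N\<close> be the first index moved down.
  Without such an index Case 1 holds; otherwise Case 2 holds with \<open>s = N - 1\<close>, unless
  \<open>b (N - 1)\<close> is moved past \<open>b N\<close>, when Case 3 holds with \<open>s = N - 2\<close>.
\<close>

text \<open>Any point of the interval other than the selected one is kept inside by the hypothesis
  on \<open>w\<close>.\<close>

lemma exiting_point_eq:
  assumes "\<forall>I\<in>Int_fin. w I \<in> I \<and> \<beta> ` (I - {w I}) \<subseteq> I"
    and "t \<in> {x..y}" and "\<beta> t \<notin> {x..y}"
  shows "w {x..y} = t"
proof (rule ccontr)
  assume "w {x..y} \<noteq> t"
  moreover have "{x..y} \<in> Int_fin"
    using assms(2) unfolding Int_fin_def by auto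
  ultimately show False
    using assms by blast
qed

text \<open>If both endpoints left, \<open>w {p..q}\<close> would equal each of them, although
  \<open>p < q\<close>.\<close>

lemma one_endpoint_stays:
  assumes "\<forall>I\<in>Int_fin. w I \<in> I \<and> \<beta> ` (I - {w I}) \<subseteq> I" and "p < q"
  shows "\<beta> p \<in> {p..q} \<or> \<beta> q \<in> {p..q}"
  using exiting_point_eq[OF assms(1), of p p q] exiting_point_eq[OF assms(1), of q p q] assms(2)
  by fastforce

lemma nonfixed_seq_Fin:
  assumes "nonfixed_seq \<beta> l b" and "n \<in> idx 0 l"
  shows "\<exists>c. b n = Fin (int c) \<and> \<beta> c \<noteq> c"
  using assms unfolding nonfixed_seq_def by blast

text \<open>Only \<open>n = l\<close> with \<open>l\<close> finite meets the assumptions, including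
  \<open>n = l = -1\<close>; the next term is then the added value \<open>Pinf\<close>.\<close>

lemma nonfixed_seq_Suc:
  assumes "nonfixed_seq \<beta> l b" and "n \<in> idx (-1) l" and "n + 1 \<notin> idx 0 l"
  shows "b (n + 1) = Pinf"
proof (cases l)
  case (Fin k)
  then have "n = k"
    using assms(2,3) by (auto simp: idx_def)
  then show ?thesis
    using assms(1) Fin by (simp add: nonfixed_seq_def)
qed (use assms in \<open>auto simp: idx_def nonfixed_seq_def\<close>)

text \<open>Uniqueness makes \<open>THE n. P n\<close> satisfy \<open>P\<close>, and leaving the
  interval on either side forces \<open>w\<close> to select that point. \<open>P\<close> is left
  abstract to cover every index range and direction occurring in the three cases.\<close>

lemma selects_unique:
  assumes w: "\<forall>I\<in>Int_fin. w I \<in> I \<and> \<beta> ` (I - {w I}) \<subseteq> I"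
    and b: "nonfixed_seq \<beta> l b"
    and sub: "\<And>n. P n \<Longrightarrow> n \<in> idx 0 l \<and> (exits_above \<beta> b x y n \<or> exits_below \<beta> b x y n)"
    and ex: "\<exists>!n. P n"
  shows "Fin (int (w {x..y})) = b (THE n. P n)"
proof -
  define n where "n = (THE n. P n)"
  have n: "P n"
    unfolding n_def using ex by (rule theI')
  then obtain c where c: "b n = Fin (int c)"
    using nonfixed_seq_Fin[OF b] sub by blast
  have "w {x..y} = c"
    using sub[OF n] exiting_point_eq[OF w, of c x y]
    by (auto simp: c exits_above_def exits_below_def)
  then show ?thesis
    using c by (simp add: n_def)
qed

theorem proposition5p2:
  fixes \<beta> :: "nat \<Rightarrow> nat" and w :: "nat set \<Rightarrow> nat"
    and l :: "int extended" and b :: "int \<Rightarrow> int extended"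
  assumes w: "\<forall>I\<in>Int_fin. w I \<in> I \<and> \<beta> ` (I - {w I}) \<subseteq> I"
    and b: "nonfixed_seq \<beta> l b"
  shows
    "((\<forall>n\<in>idx 0 l. b n < ext \<beta> (b n) \<and> ext \<beta> (b n) \<le> b (n + 1)) \<and>
      (\<forall>x y. x \<le> y \<longrightarrow>
        ((\<exists>!n. n \<in> idx 0 l \<and> exits_above \<beta> b x y n) \<longrightarrow>
          Fin (int (w {x..y})) = b (THE n. n \<in> idx 0 l \<and> exits_above \<beta> b x y n)) \<and>
        (\<not> (\<exists>!n. n \<in> idx 0 l \<and> exits_above \<beta> b x y n) \<longrightarrow> w {x..y} \<in> {x..y})))
    \<or>
     (\<exists>s\<in>idx (-1) (l - 1).
      (\<forall>m\<in>idx (-1) (Fin s). b m < ext \<beta> (b m) \<and> ext \<beta> (b m) \<le> b (m + 1)) \<and>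
      ext \<beta> (b (s + 1)) < b (s + 1) \<and>
      (\<forall>m\<in>idx (s + 2) l. b (m - 1) \<le> ext \<beta> (b m) \<and> ext \<beta> (b m) < b m) \<and>
      (\<forall>x y. x \<le> y \<longrightarrow>
        ((\<exists>!n. n \<in> idx 0 (Fin s) \<and> exits_above \<beta> b x y n) \<longrightarrow>
          Fin (int (w {x..y})) = b (THE n. n \<in> idx 0 (Fin s) \<and> exits_above \<beta> b x y n)) \<and>
        ((\<exists>!n. n \<in> idx (s + 1) l \<and> exits_below \<beta> b x y n) \<longrightarrow>
          Fin (int (w {x..y})) = b (THE n. n \<in> idx (s + 1) l \<and> exits_below \<beta> b x y n)) \<and>
        (\<not> (\<exists>!n. n \<in> idx 0 (Fin s) \<and> exits_above \<beta> b x y n) \<and>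
         \<not> (\<exists>!n. n \<in> idx (s + 1) l \<and> exits_below \<beta> b x y n) \<longrightarrow> w {x..y} \<in> {x..y})))
    \<or>
     (\<exists>s\<in>idx (-1) (l - 1).
      (\<forall>m\<in>idx (-1) (Fin s). b m < ext \<beta> (b m) \<and> ext \<beta> (b m) \<le> b (m + 1)) \<and>
      ext \<beta> (b (s + 1)) > b (s + 2) \<and>
      (\<forall>m\<in>idx (s + 2) l. b (m - 1) \<le> ext \<beta> (b m) \<and> ext \<beta> (b m) < b m) \<and>
      (\<forall>x y. x \<le> y \<longrightarrow>
        ((\<exists>!n. n \<in> idx 0 (Fin s) \<and> exits_above \<beta> b x y n) \<longrightarrow>
          Fin (int (w {x..y})) = b (THE n. n \<in> idx 0 (Fin s) \<and> exits_above \<beta> b x y n)) \<and>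
        ((\<exists>!n. n \<in> idx (s + 1) l \<and> exits_below \<beta> b x y n) \<longrightarrow>
          Fin (int (w {x..y})) = b (THE n. n \<in> idx (s + 1) l \<and> exits_below \<beta> b x y n)) \<and>
        (\<not> (\<exists>!n. n \<in> idx 0 (Fin s) \<and> exits_above \<beta> b x y n) \<and>
         \<not> (\<exists>!n. n \<in> idx (s + 1) l \<and> exits_below \<beta> b x y n) \<longrightarrow> w {x..y} \<in> {x..y})))"
proof -
  define up where "up n \<longleftrightarrow> b n < ext \<beta> (b n)" for n
  define down where "down n \<longleftrightarrow> ext \<beta> (b n) < b n" for n
  have up_or_down: "up n \<or> down n" if n: "n \<in> idx 0 l" for n
    using nonfixed_seq_Fin[OF b n] by (auto simp: up_def down_def)
  have pair: "(b n \<le> ext \<beta> (b n) \<and> ext \<beta> (b n) \<le> b (n + 1)) \<or>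
      (b n \<le> ext \<beta> (b (n + 1)) \<and> ext \<beta> (b (n + 1)) \<le> b (n + 1))"
    if n: "n \<in> idx 0 l" and n1: "n + 1 \<in> idx 0 l" for n
  proof -
    have less: "b n < b (n + 1)"
      using b n n1 unfolding nonfixed_seq_def strict_mono_on_def by auto
    obtain p where p: "b n = Fin (int p)"
      using nonfixed_seq_Fin[OF b n] by blast
    obtain q where q: "b (n + 1) = Fin (int q)"
      using nonfixed_seq_Fin[OF b n1] by blast
    show ?thesis
      using one_endpoint_stays[OF w, of p q] less by (auto simp: p q)
  qed
  have idx_mono: "m \<in> idx 0 l" if "n \<in> idx 0 l" "0 \<le> m" "m \<le> n" for m n
    using that by (cases l) (auto simp: idx_def)
  have down_Suc: "down (n + 1)" if "n \<in> idx 0 l" "n + 1 \<in> idx 0 l" "down n" for n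
    using pair[OF that(1,2)] up_or_down[OF that(2)] that(3) by (auto simp: up_def down_def)
  \<comment> \<open>A successor moved up leaves the interval spanned by the two points, so by
    \<open>pair\<close> the image of \<open>b n\<close> stays in it. At the last index the bound is
    \<open>Pinf\<close>.\<close>
  have up_le: "ext \<beta> (b n) \<le> b (n + 1)"
    if "n \<in> idx 0 l" "n + 1 \<in> idx 0 l \<Longrightarrow> up (n + 1)" for n
  proof (cases "n + 1 \<in> idx 0 l")
    case True
    then show ?thesis
      using pair[OF that(1) True] that(2)[OF True] by (auto simp: up_def)
  next
    case False
    moreover have "n \<in> idx (-1) l"
      using that(1) by (auto simp: idx_def)
    ultimately show ?thesis
      using nonfixed_seq_Suc[OF b] by simp
  qed
  \<comment> \<open>Either disjunct makes \<open>b (n - 1)\<close> leave the interval from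
    \<open>b (n - 1)\<close> to \<open>b n\<close>, below or above, so the image of
    \<open>b n\<close> stays in it.\<close>
  have down_ge: "b (n - 1) \<le> ext \<beta> (b n)"
    if "n \<in> idx 0 l" "n - 1 \<in> idx 0 l" "down n" "down (n - 1) \<or> b n < ext \<beta> (b (n - 1))" for n
    using pair[of "n - 1"] that by (auto simp: down_def)
  \<comment> \<open>The added index \<open>-1\<close> has value \<open>-1\<close> and image
    \<open>0\<close>, and every non-fixed point is at least \<open>0\<close>.\<close>
  have start: "b (-1) < ext \<beta> (b (-1))" "ext \<beta> (b (-1)) \<le> b 0" if "0 \<in> idx 0 l"
    using nonfixed_seq_Fin[OF b that] b by (auto simp: nonfixed_seq_def)
  have mem: "w {x..y} \<in> {x..y}" if "x \<le> y" for x y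
    using w that unfolding Int_fin_def by blast
  show ?thesis
  proof (cases "\<exists>n\<in>idx 0 l. down n")
    case False
    then have "\<forall>n\<in>idx 0 l. up n"
      using up_or_down by blast
    then have "\<forall>n\<in>idx 0 l. b n < ext \<beta> (b n) \<and> ext \<beta> (b n) \<le> b (n + 1)"
      using up_le by (simp add: up_def)
    moreover have "Fin (int (w {x..y})) = b (THE n. n \<in> idx 0 l \<and> exits_above \<beta> b x y n)"
      if "\<exists>!n. n \<in> idx 0 l \<and> exits_above \<beta> b x y n" for x y
      by (rule selects_unique[OF w b _ that]) blast
    ultimately show ?thesis
      using mem by (intro disjI1) blast
  next
    case True
    \<comment> \<open>The minimum is taken over naturals, which are well-ordered; indices in
      \<open>idx 0 l\<close> are nonnegative, so none is lost.\<close>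
    define N where "N = int (LEAST k. int k \<in> idx 0 l \<and> down (int k))"
    obtain n where n: "n \<in> idx 0 l" "down n"
      using True by blast
    then have ex: "int (nat n) \<in> idx 0 l \<and> down (int (nat n))"
      by (simp add: idx_def)
    have N: "N \<in> idx 0 l" "down N"
      using LeastI[of "\<lambda>k. int k \<in> idx 0 l \<and> down (int k)", OF ex] by (simp_all add: N_def)
    have N0: "N \<ge> 0"
      by (simp add: N_def)
    then have zero: "0 \<in> idx 0 l"
      using idx_mono[OF N(1)] by simp
    have below: "m \<in> idx 0 l \<and> up m" if "0 \<le> m" "m < N" for m
    proof -
      have m: "m \<in> idx 0 l"
        using idx_mono[OF N(1)] that by simp
      have "\<not> (int (nat m) \<in> idx 0 l \<and> down (int (nat m)))"
        by (rule not_less_Least) (use that in \<open>simp add: N_def\<close>)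
      then show ?thesis
        using m that up_or_down[OF m] by simp
    qed
    have above: "down m" if "N \<le> m" "m \<in> idx 0 l" for m
      using that
    proof (induction m rule: int_ge_induct)
      case (step i)
      then have "i \<in> idx 0 l"
        using idx_mono[OF step.prems] N0 by simp
      then show ?case
        using step down_Suc by blast
    qed (use N in simp)
    \<comment> \<open>Serves \<open>s = N - 1\<close> and \<open>s = N - 2\<close>. At
      \<open>m = N - 1\<close> the successor is moved down and \<open>up_le\<close> does not apply,
      so the bound is a premise there.\<close>
    have up_part: "b m < ext \<beta> (b m) \<and> ext \<beta> (b m) \<le> b (m + 1)"
      if "s < N" "s = N - 1 \<Longrightarrow> 0 \<le> s \<Longrightarrow> ext \<beta> (b s) \<le> b N" "m \<in> idx (-1) (Fin s)" for s m
    proof -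
      have "-1 \<le> m" "m \<le> s"
        using that(3) by (simp_all add: idx_def)
      with that(1) consider "m = -1" | "0 \<le> m" "m = N - 1" "m = s" | "0 \<le> m" "m + 1 < N"
        by linarith
      then show ?thesis
      proof cases
        case 1
        then show ?thesis using start zero by simp
      next
        case 2
        then show ?thesis using below[of m] that(2) by (simp add: up_def)
      next
        case 3
        then show ?thesis using below[of m] below[of "m + 1"] up_le[of m] by (simp add: up_def)
      qed
    qed
    \<comment> \<open>Serves \<open>k = N + 1\<close> and \<open>k = N\<close>. At
      \<open>m = N\<close> the predecessor is moved up, and the last premise says that it overshoots
      \<open>b N\<close>; \<open>1 \<le> k\<close> keeps \<open>m - 1\<close> away from the added
      index \<open>-1\<close>.\<close>
    have down_part: "b (m - 1) \<le> ext \<beta> (b m) \<and> ext \<beta> (b m) < b m"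
      if "m \<in> idx k l" "N \<le> k" "1 \<le> k" "k = N \<Longrightarrow> b N < ext \<beta> (b (N - 1))" for k m
    proof -
      have m: "m \<in> idx 0 l" "k \<le> m"
        using that by (auto simp: idx_def)
      then have m1: "m - 1 \<in> idx 0 l"
        using idx_mono[OF m(1)] that(3) by simp
      have "down (m - 1) \<or> b m < ext \<beta> (b (m - 1))"
      proof (cases "m = N")
        case True
        then show ?thesis using that m by auto
      next
        case False
        then show ?thesis using above[OF _ m1] m that(2) by simp
      qed
      then show ?thesis
        using down_ge[OF m(1) m1] above[OF _ m(1)] m that(2) by (auto simp: down_def)
    qed
    have choice: "\<forall>x y. x \<le> y \<longrightarrow>
        ((\<exists>!n. n \<in> idx 0 (Fin s) \<and> exits_above \<beta> b x y n) \<longrightarrow>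
          Fin (int (w {x..y})) = b (THE n. n \<in> idx 0 (Fin s) \<and> exits_above \<beta> b x y n)) \<and>
        ((\<exists>!n. n \<in> idx (s + 1) l \<and> exits_below \<beta> b x y n) \<longrightarrow>
          Fin (int (w {x..y})) = b (THE n. n \<in> idx (s + 1) l \<and> exits_below \<beta> b x y n)) \<and>
        (\<not> (\<exists>!n. n \<in> idx 0 (Fin s) \<and> exits_above \<beta> b x y n) \<and>
         \<not> (\<exists>!n. n \<in> idx (s + 1) l \<and> exits_below \<beta> b x y n) \<longrightarrow> w {x..y} \<in> {x..y})"
      if "-1 \<le> s" "s < N" for s
    proof -
      \<comment> \<open>Both index ranges lie in \<open>idx 0 l\<close>: the first because
        \<open>s < N\<close>, the second because \<open>-1 \<le> s\<close>.\<close>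
      have "Fin (int (w {x..y})) = b (THE n. n \<in> idx 0 (Fin s) \<and> exits_above \<beta> b x y n)"
        if ex: "\<exists>!n. n \<in> idx 0 (Fin s) \<and> exits_above \<beta> b x y n" for x y
      proof (rule selects_unique[OF w b _ ex])
        fix n assume n: "n \<in> idx 0 (Fin s) \<and> exits_above \<beta> b x y n"
        then have "n \<in> idx 0 l"
          using \<open>s < N\<close> idx_mono[OF N(1), of n] by (simp add: idx_def)
        with n show "n \<in> idx 0 l \<and> (exits_above \<beta> b x y n \<or> exits_below \<beta> b x y n)"
          by blast
      qed
      moreover have "Fin (int (w {x..y})) = b (THE n. n \<in> idx (s + 1) l \<and> exits_below \<beta> b x y n)"
        if ex: "\<exists>!n. n \<in> idx (s + 1) l \<and> exits_below \<beta> b x y n" for x y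
      proof (rule selects_unique[OF w b _ ex])
        fix n assume n: "n \<in> idx (s + 1) l \<and> exits_below \<beta> b x y n"
        then have "n \<in> idx 0 l"
          using \<open>-1 \<le> s\<close> by (simp add: idx_def)
        with n show "n \<in> idx 0 l \<and> (exits_above \<beta> b x y n \<or> exits_below \<beta> b x y n)"
          by blast
      qed
      ultimately show ?thesis
        using mem by blast
    qed
    have s_idx: "s \<in> idx (-1) (l - 1)" if "-1 \<le> s" "s < N" for s
      using that N(1) by (cases l) (auto simp: idx_def one_extended_def)
    show ?thesis
    \<comment> \<open>The guard \<open>1 \<le> N\<close> sends \<open>N = 0\<close> to Case 2 with
      \<open>s = -1\<close>, and ensures \<open>N - 2 \<ge> -1\<close> in Case 3.\<close>
    proof (cases "1 \<le> N \<and> b N < ext \<beta> (b (N - 1))")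
      case False
      have "ext \<beta> (b (N - 1)) \<le> b N" if "0 \<le> N - 1"
        using False that by auto
      then have "\<forall>m\<in>idx (-1) (Fin (N - 1)). b m < ext \<beta> (b m) \<and> ext \<beta> (b m) \<le> b (m + 1)"
        using up_part[of "N - 1"] by simp
      moreover have "ext \<beta> (b (N - 1 + 1)) < b (N - 1 + 1)"
        using N by (simp add: down_def)
      moreover have "\<forall>m\<in>idx (N - 1 + 2) l. b (m - 1) \<le> ext \<beta> (b m) \<and> ext \<beta> (b m) < b m"
        using down_part[of _ "N - 1 + 2"] N0 by simp
      ultimately show ?thesis
        using choice[of "N - 1"] s_idx[of "N - 1"] N0
        by (intro disjI2[OF disjI1] bexI[of _ "N - 1"] conjI) simp_all
    next
      case True
      have "\<forall>m\<in>idx (-1) (Fin (N - 2)). b m < ext \<beta> (b m) \<and> ext \<beta> (b m) \<le> b (m + 1)"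
        using up_part[of "N - 2"] by simp
      moreover have "ext \<beta> (b (N - 2 + 1)) > b (N - 2 + 2)"
        using True by simp
      \<comment> \<open>Here the downward range starts at \<open>N\<close> itself, so the overshoot
        of \<open>b (N - 1)\<close> is what \<open>down_part\<close> requires.\<close>
      moreover have "\<forall>m\<in>idx (N - 2 + 2) l. b (m - 1) \<le> ext \<beta> (b m) \<and> ext \<beta> (b m) < b m"
        using down_part[of _ "N - 2 + 2"] True by simp
      ultimately show ?thesis
        using choice[of "N - 2"] s_idx[of "N - 2"] True
        by (intro disjI2[OF disjI2] bexI[of _ "N - 2"] conjI) simp_all
    qed
  qed
qed

end
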